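(* Let $\langle x_n\rangle_{n=1}^\infty$ be an almost minimal sequence in $(\mathbb{N},+)$ and let $A\subseteq\mathbb{N}$ be a $C^\star$-set in $(\mathbb{N},+)$. Then there exists a sum subsystem $\langle y_n\rangle_{n=1}^\infty$ of $\langle x_n\rangle_{n=1}^\infty$ such that $$FS(\langle y_n\rangle_{n=1}^\infty)\cup FP(\langle y_n\rangle_{n=1}^\infty)\subseteq A.$$
   Context: $\mathbb{N}$ is the set of positive integers, and for a set $X$, $\mathcal{P}_f(X)$ is the set of finite nonempty subsets of $X$. $\beta\mathbb{N}$ is the set of ultrafilters on $\mathbb{N}$ (with points of $\mathbb{N}$ identified with principal ultrafilters), topologized with basis $\{\overline{A}:A\subseteq\mathbb{N}\}$, where $\overline{A}=c\ell A=\{p\in\beta\mathbb{N}:A\in p\}$. Addition extends to $\beta\mathbb{N}$ by: $A\in p+q$ iff $\{x\in\mathbb{N}:-x+A\in q\}\in p$, where $-x+A=\{y\in\mathbb{N}:x+y\in A\}$. An idempotent is $p\in\beta\mathbb{N}$ with $p+p=p$. J-sets: a set $A\subseteq\mathbb{N}$ is a $J$-set (in $(\mathbb{N},+)$) if for every finite nonempty set $F$ of sequences $f:\mathbb{N}\to\mathbb{N}$ there exist $a\in\mathbb{N}$ and $H\in\mathcal{P}_f(\mathbb{N})$ such that $a+\sum_{t\in H}f(t)\in A$ for all $f\in F$. $J(\mathbb{N})=\{p\in\beta\mathbb{N}:\text{every }A\in p\text{ is a }J\text{-set}\}$. $C^\star$-sets: $A\subseteq\mathbb{N}$ is a $C^\star$-set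 in $(\mathbb{N},+)$ if $A\in p$ for every idempotent $p\in J(\mathbb{N})$. For a sequence $\langle x_n\rangle$ in $\mathbb{N}$ and $m\in\mathbb{N}$, $FS(\langle x_n\rangle_{n=m}^\infty)=\{\sum_{n\in F}x_n:F\in\mathcal{P}_f(\mathbb{N}),\ \min F\ge m\}$ and $FP(\langle x_n\rangle_{n=m}^\infty)=\{\prod_{n\in F}x_n:F\in\mathcal{P}_f(\mathbb{N}),\ \min F\ge m\}$. Almost minimal: a sequence $\langle x_n\rangle_{n=1}^\infty$ in $\mathbb{N}$ is almost minimal if $\bigcap_{m=1}^\infty c\ell\, FS(\langle x_n\rangle_{n=m}^\infty)\cap J(\mathbb{N})\neq\emptyset$. Sum subsystem: $\langle y_n\rangle_{n=1}^\infty$ is a sum subsystem of $\langle x_n\rangle_{n=1}^\infty$ if there is a sequence $\langle H_n\rangle_{n=1}^\infty$ in $\mathcal{P}_f(\mathbb{N})$ with $\max H_n<\min H_{n+1}$ and $y_n=\sum_{t\in H_n}x_t$ for each $n\in\mathbb{N}$. *)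

theory Defs
  imports "HOL-Library.FuncSet"
begin

text \<open>
  The positive integers are the subset \<open>\<nat>\<^sub>+\<close> of type \<open>nat\<close>. A sequence in \<open>\<nat>\<^sub>+\<close> is a function in
  \<open>\<nat>\<^sub>+ \<rightarrow> \<nat>\<^sub>+\<close>; its value at the index 0 is never used.
\<close>

abbreviation pos_nats :: "nat set"  ("\<nat>\<^sub>+") where
  "\<nat>\<^sub>+ \<equiv> {1..}"

definition fin_nonempty :: "'a set \<Rightarrow> 'a set set"  ("\<P>\<^sub>f") where
  "\<P>\<^sub>f X = {F. F \<subseteq> X \<and> finite F \<and> F \<noteq> {}}"

definition ultrafilter_on :: "'a set \<Rightarrow> 'a set set \<Rightarrow> bool" where
  "ultrafilter_on X p \<longleftrightarrow>
     p \<subseteq> Pow X \<and> X \<in> p \<and> {} \<notin> p \<and>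
     (\<forall>A B. A \<in> p \<and> B \<in> p \<longrightarrow> A \<inter> B \<in> p) \<and>
     (\<forall>A B. A \<in> p \<and> A \<subseteq> B \<and> B \<subseteq> X \<longrightarrow> B \<in> p) \<and>
     (\<forall>A. A \<subseteq> X \<longrightarrow> A \<in> p \<or> X - A \<in> p)"

definition beta_N :: "nat set set set"  ("\<beta>\<nat>") where
  "\<beta>\<nat> = {p. ultrafilter_on \<nat>\<^sub>+ p}"

text \<open>
  The basic clopen set \<open>{p \<in> \<beta>\<nat>. A \<in> p}\<close>, which is the closure of \<open>A\<close> in \<open>\<beta>\<nat>\<close>, points of \<open>\<nat>\<^sub>+\<close>
  being identified with principal ultrafilters.
\<close>

definition cl :: "nat set \<Rightarrow> nat set set set" where
  "cl A = {p \<in> \<beta>\<nat>. A \<in> p}"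

definition shift :: "nat \<Rightarrow> nat set \<Rightarrow> nat set" where
  "shift x A = {y \<in> \<nat>\<^sub>+. x + y \<in> A}"

definition beta_plus :: "nat set set \<Rightarrow> nat set set \<Rightarrow> nat set set"  (infixl "\<oplus>\<^sub>\<beta>" 65) where
  "p \<oplus>\<^sub>\<beta> q = {A. A \<subseteq> \<nat>\<^sub>+ \<and> {x \<in> \<nat>\<^sub>+. shift x A \<in> q} \<in> p}"

definition idempotent :: "nat set set \<Rightarrow> bool" where
  "idempotent p \<longleftrightarrow> p \<in> \<beta>\<nat> \<and> p \<oplus>\<^sub>\<beta> p = p"

definition J_set :: "nat set \<Rightarrow> bool" where
  "J_set A \<longleftrightarrow> A \<subseteq> \<nat>\<^sub>+ \<and>
     (\<forall>F \<in> \<P>\<^sub>f (\<nat>\<^sub>+ \<rightarrow> \<nat>\<^sub>+). \<exists>a \<in> \<nat>\<^sub>+. \<exists>H \<in> \<P>\<^sub>f \<nat>\<^sub>+. \<forall>f \<in> F. a + (\<Sum>t\<in>H. f t) \<in> A)"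

definition J_N :: "nat set set set" where
  "J_N = {p \<in> \<beta>\<nat>. \<forall>A \<in> p. J_set A}"

definition C_star_set :: "nat set \<Rightarrow> bool" where
  "C_star_set A \<longleftrightarrow> A \<subseteq> \<nat>\<^sub>+ \<and> (\<forall>p. idempotent p \<and> p \<in> J_N \<longrightarrow> A \<in> p)"

definition FS :: "(nat \<Rightarrow> nat) \<Rightarrow> nat \<Rightarrow> nat set" where
  "FS x m = {\<Sum>n\<in>F. x n | F. F \<in> \<P>\<^sub>f \<nat>\<^sub>+ \<and> Min F \<ge> m}"

definition FP :: "(nat \<Rightarrow> nat) \<Rightarrow> nat \<Rightarrow> nat set" where
  "FP x m = {\<Prod>n\<in>F. x n | F. F \<in> \<P>\<^sub>f \<nat>\<^sub>+ \<and> Min F \<ge> m}"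

definition almost_minimal :: "(nat \<Rightarrow> nat) \<Rightarrow> bool" where
  "almost_minimal x \<longleftrightarrow> x \<in> \<nat>\<^sub>+ \<rightarrow> \<nat>\<^sub>+ \<and> (\<Inter>m\<in>\<nat>\<^sub>+. cl (FS x m)) \<inter> J_N \<noteq> {}"

definition sum_subsystem :: "(nat \<Rightarrow> nat) \<Rightarrow> (nat \<Rightarrow> nat) \<Rightarrow> bool" where
  "sum_subsystem y x \<longleftrightarrow>
     (\<exists>H. H \<in> \<nat>\<^sub>+ \<rightarrow> \<P>\<^sub>f \<nat>\<^sub>+ \<and>
        (\<forall>n\<in>\<nat>\<^sub>+. Max (H n) < Min (H (n + 1))) \<and>
        (\<forall>n\<in>\<nat>\<^sub>+. y n = (\<Sum>t\<in>H n. x t)))"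

end

theory Submission
  imports Defs "HOL-Library.Infinite_Set" "HOL-Library.Disjoint_Sets"
begin

text \<open>
  The closed semigroup \<open>\<Inter>\<^sub>m cl (FS x m) \<inter> J_N\<close> contains an idempotent \<open>p\<close>. Every dilate of \<open>p\<close> is again
  an idempotent in \<open>J_N\<close>, because dilates of J-sets are J-sets; hence \<open>p\<close> contains \<open>A\<close> and all the
  sets \<open>{m. s * m \<in> A}\<close>. Put \<open>A\<^sup>* = {a \<in> A. -a + A \<in> p}\<close>, so that \<open>-a + A\<^sup>* \<in> p\<close> for \<open>a \<in> A\<^sup>*\<close>. The
  blocks \<open>H n\<close> are chosen one by one, the next term being taken from a member of \<open>p\<close> that keeps all
  finite sums in \<open>A\<^sup>*\<close> and all finite products in \<open>A\<close>.

  The idempotent is found with filters in place of closed subsemigroups of \<open>\<beta>\<nat>\<close>: a filter \<open>\<phi>\<close> that is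
  maximal subject to \<open>\<phi> \<subseteq> \<phi> + \<phi>\<close> is an idempotent ultrafilter.
\<close>

section \<open>Filters and ultrafilters\<close>

text \<open>Repeats the clauses of \<open>ultrafilter_on\<close> in the same order up to the last
  one, so that \<open>ultrafilter_on_iff\<close> is mere associativity of conjunction.\<close>

definition filter_on :: "'a set \<Rightarrow> 'a set set \<Rightarrow> bool" where
  "filter_on X p \<longleftrightarrow>
     p \<subseteq> Pow X \<and> X \<in> p \<and> {} \<notin> p \<and>
     (\<forall>A B. A \<in> p \<and> B \<in> p \<longrightarrow> A \<inter> B \<in> p) \<and>
     (\<forall>A B. A \<in> p \<and> A \<subseteq> B \<and> B \<subseteq> X \<longrightarrow> B \<in> p)"

lemma filter_on_subset: "filter_on X p \<Longrightarrow> A \<in> p \<Longrightarrow> A \<subseteq> X"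
  and filter_on_top: "filter_on X p \<Longrightarrow> X \<in> p"
  and filter_on_empty: "filter_on X p \<Longrightarrow> {} \<notin> p"
  and filter_on_Int: "filter_on X p \<Longrightarrow> A \<in> p \<Longrightarrow> B \<in> p \<Longrightarrow> A \<inter> B \<in> p"
  and filter_on_mono: "filter_on X p \<Longrightarrow> A \<in> p \<Longrightarrow> A \<subseteq> B \<Longrightarrow> B \<subseteq> X \<Longrightarrow> B \<in> p"
  unfolding filter_on_def by blast+

lemma filter_on_INT:
  assumes "filter_on X p" "finite I" "\<And>i. i \<in> I \<Longrightarrow> B i \<in> p"
  shows "X \<inter> (\<Inter>i\<in>I. B i) \<in> p"
  using assms(2,3)
proof (induction I rule: finite_induct)
  case empty
  then show ?case by (simp add: filter_on_top[OF assms(1)])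
next
  case (insert i I)
  then have "B i \<inter> (X \<inter> (\<Inter>i\<in>I. B i)) \<in> p"
    using filter_on_Int[OF assms(1), of "B i" "X \<inter> (\<Inter>i\<in>I. B i)"] by simp
  also have "B i \<inter> (X \<inter> (\<Inter>i\<in>I. B i)) = X \<inter> (\<Inter>i\<in>insert i I. B i)" by auto
  finally show ?case .
qed

lemma ultrafilter_on_iff:
  "ultrafilter_on X p \<longleftrightarrow> filter_on X p \<and> (\<forall>A. A \<subseteq> X \<longrightarrow> A \<in> p \<or> X - A \<in> p)"
  by (simp only: ultrafilter_on_def filter_on_def conj_assoc)

lemma ultrafilter_on_Diff_iff:
  assumes "ultrafilter_on X p" "A \<subseteq> X"
  shows "X - A \<in> p \<longleftrightarrow> A \<notin> p"
proof -
  have "A \<inter> (X - A) \<notin> p"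
    using assms filter_on_empty[of X p] by (auto simp: ultrafilter_on_iff)
  then show ?thesis
    using assms filter_on_Int[of X p A "X - A"] by (auto simp: ultrafilter_on_iff)
qed

text \<open>Supplies the upper bounds in both uses of Zorn's lemma. Two sets from different members
  of \<open>C\<close> lie in the larger of these members.\<close>

lemma filter_on_Union_chain:
  assumes "C \<noteq> {}" "subset.chain S C" "\<And>p. p \<in> C \<Longrightarrow> filter_on X p"
  shows "filter_on X (\<Union>C)"
proof -
  have Int: "A \<inter> B \<in> \<Union>C" if pq: "p \<in> C" "q \<in> C" "A \<in> p" "B \<in> q" for A B p q
  proof -
    have "p \<subseteq> q \<or> q \<subseteq> p"
      using assms(2) pq(1,2) by (auto simp: subset_chain_def)
    then obtain r where "r \<in> C" "A \<in> r" "B \<in> r"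
      using pq by blast
    then show ?thesis
      using filter_on_Int[OF assms(3)] by blast
  qed
  have mono: "B \<in> \<Union>C" if "p \<in> C" "A \<in> p" "A \<subseteq> B" "B \<subseteq> X" for A B p
    using filter_on_mono[OF assms(3)[OF that(1)] that(2-4)] that(1) by blast
  have "\<Union>C \<subseteq> Pow X" "X \<in> \<Union>C" "{} \<notin> \<Union>C"
    using assms(1) filter_on_subset[OF assms(3)] filter_on_top[OF assms(3)]
      filter_on_empty[OF assms(3)] by blast+
  then show ?thesis
    unfolding filter_on_def
  proof (intro conjI allI impI)
    fix A B
    show "A \<inter> B \<in> \<Union>C" if AB: "A \<in> \<Union>C \<and> B \<in> \<Union>C"
    proof -
      obtain p q where "p \<in> C" "q \<in> C" "A \<in> p" "B \<in> q" using AB by blast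
      then show ?thesis by (rule Int)
    qed
    show "B \<in> \<Union>C" if "A \<in> \<Union>C \<and> A \<subseteq> B \<and> B \<subseteq> X"
    proof -
      obtain p where "p \<in> C" "A \<in> p" using \<open>A \<in> \<Union>C \<and> A \<subseteq> B \<and> B \<subseteq> X\<close> by blast
      then show ?thesis by (rule mono) (use that in auto)
    qed
  qed
qed

text \<open>The filter generated by \<open>p\<close> and a downward directed family; the last
  assumption keeps it proper. It serves to enlarge a filter that is supposed to be maximal, by one
  set in \<open>ultrafilter_on_extends\<close> and by a whole family in
  \<open>maximal_filter_idempotent\<close>.\<close>

lemma filter_on_generated:
  assumes "filter_on X p"
    and "\<And>S T. S \<in> \<B> \<Longrightarrow> T \<in> \<B> \<Longrightarrow> \<exists>U\<in>\<B>. U \<subseteq> S \<inter> T"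
    and "\<B> \<noteq> {}" and "\<And>S C. S \<in> \<B> \<Longrightarrow> C \<in> p \<Longrightarrow> C \<inter> S \<noteq> {}"
  shows "filter_on X {B. B \<subseteq> X \<and> (\<exists>S\<in>\<B>. \<exists>C\<in>p. C \<inter> S \<subseteq> B)}"
  unfolding filter_on_def
proof (intro conjI allI impI)
  show "X \<in> {B. B \<subseteq> X \<and> (\<exists>S\<in>\<B>. \<exists>C\<in>p. C \<inter> S \<subseteq> B)}"
    using assms(1,3) filter_on_top by blast
  show "{} \<notin> {B. B \<subseteq> X \<and> (\<exists>S\<in>\<B>. \<exists>C\<in>p. C \<inter> S \<subseteq> B)}"
    using assms(4) by blast
next
  fix A B
  assume "A \<in> {B. B \<subseteq> X \<and> (\<exists>S\<in>\<B>. \<exists>C\<in>p. C \<inter> S \<subseteq> B)} \<and>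
    B \<in> {B. B \<subseteq> X \<and> (\<exists>S\<in>\<B>. \<exists>C\<in>p. C \<inter> S \<subseteq> B)}"
  then obtain S C T D where *: "A \<subseteq> X" "S \<in> \<B>" "C \<in> p" "C \<inter> S \<subseteq> A"
      "T \<in> \<B>" "D \<in> p" "D \<inter> T \<subseteq> B" by blast
  moreover obtain U where "U \<in> \<B>" "U \<subseteq> S \<inter> T"
    using assms(2) * by meson
  moreover have "C \<inter> D \<in> p"
    using assms(1) * filter_on_Int by blast
  moreover have "(C \<inter> D) \<inter> U \<subseteq> A \<inter> B" using calculation by blast
  ultimately show "A \<inter> B \<in> {B. B \<subseteq> X \<and> (\<exists>S\<in>\<B>. \<exists>C\<in>p. C \<inter> S \<subseteq> B)}"
    by blast
next
  fix A B
  assume "A \<in> {B. B \<subseteq> X \<and> (\<exists>S\<in>\<B>. \<exists>C\<in>p. C \<inter> S \<subseteq> B)} \<and> A \<subseteq> B \<and> B \<subseteq> X"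
  then obtain S C where "S \<in> \<B>" "C \<in> p" "C \<inter> S \<subseteq> A" "A \<subseteq> B" "B \<subseteq> X" by blast
  then have "C \<inter> S \<subseteq> B" by simp
  then show "B \<in> {B. B \<subseteq> X \<and> (\<exists>S\<in>\<B>. \<exists>C\<in>p. C \<inter> S \<subseteq> B)}"
    using \<open>S \<in> \<B>\<close> \<open>C \<in> p\<close> \<open>B \<subseteq> X\<close> by blast
qed auto

lemma ultrafilter_on_extends:
  assumes "filter_on X p"
  obtains q where "ultrafilter_on X q" "p \<subseteq> q"
proof -
  obtain q where q: "filter_on X q" "p \<subseteq> q"
    and maximal: "\<And>r. filter_on X r \<Longrightarrow> q \<subseteq> r \<Longrightarrow> r = q"
  proof -
    have "\<exists>q\<in>{q. filter_on X q \<and> p \<subseteq> q}. \<forall>r\<in>{q. filter_on X q \<and> p \<subseteq> q}. q \<subseteq> r \<longrightarrow> r = q"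
    proof (rule subset_Zorn_nonempty)
      fix C assume C: "C \<noteq> {}" "subset.chain {q. filter_on X q \<and> p \<subseteq> q} C"
      then have "filter_on X (\<Union>C)"
        by (intro filter_on_Union_chain) (auto simp: subset_chain_def)
      moreover have "p \<subseteq> \<Union>C"
        using C unfolding subset_chain_def by blast
      ultimately show "\<Union>C \<in> {q. filter_on X q \<and> p \<subseteq> q}" by simp
    qed (use assms in auto)
    then obtain q where "filter_on X q" "p \<subseteq> q"
      "\<And>r. filter_on X r \<Longrightarrow> p \<subseteq> r \<Longrightarrow> q \<subseteq> r \<Longrightarrow> r = q"
      unfolding Ball_def mem_Collect_eq by auto
    then show ?thesis by (intro that[of q]) auto
  qed
  have "A \<in> q" if A: "A \<subseteq> X" "X - A \<notin> q" for A
  proof -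
    \<comment> \<open>As \<open>X - A\<close> is not in \<open>q\<close>, every member of
      \<open>q\<close> meets \<open>A\<close>, so adjoining \<open>A\<close> gives a proper
      filter.\<close>
    let ?r = "{B. B \<subseteq> X \<and> (\<exists>S\<in>{A}. \<exists>C\<in>q. C \<inter> S \<subseteq> B)}"
    have "filter_on X ?r"
    proof (rule filter_on_generated[OF q(1)])
      fix S C assume "S \<in> {A}" "C \<in> q"
      then show "C \<inter> S \<noteq> {}"
        using filter_on_mono[OF q(1), of C "X - A"] filter_on_subset[OF q(1), of C] A by auto
    qed auto
    moreover have "q \<subseteq> ?r"
      using filter_on_subset[OF q(1)] by blast
    ultimately have "?r = q" by (rule maximal)
    moreover have "A \<in> ?r"
      using A filter_on_top[OF q(1)] by blast
    ultimately show ?thesis by blast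
  qed
  then show ?thesis
    using q that unfolding ultrafilter_on_iff by blast
qed

text \<open>The pushforward of \<open>p\<close> along \<open>h\<close>. With addition of
  \<open>x\<close> or multiplication by \<open>s\<close> as \<open>h\<close> it is the translate or
  the dilate of \<open>p\<close> by that number.\<close>

definition filter_image :: "'b set \<Rightarrow> ('a \<Rightarrow> 'b) \<Rightarrow> 'a set \<Rightarrow> 'a set set \<Rightarrow> 'b set set" where
  "filter_image Y h X p = {A. A \<subseteq> Y \<and> {x \<in> X. h x \<in> A} \<in> p}"

lemma ultrafilter_on_image:
  assumes "ultrafilter_on X p" "h \<in> X \<rightarrow> Y"
  shows "ultrafilter_on Y (filter_image Y h X p)"
proof -
  have p: "filter_on X p" using assms(1) by (simp add: ultrafilter_on_iff)
  have top: "{x \<in> X. h x \<in> Y} = X" using assms(2) by auto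
  have Int: "{x \<in> X. h x \<in> A \<and> h x \<in> B} = {x \<in> X. h x \<in> A} \<inter> {x \<in> X. h x \<in> B}" for A B
    by auto
  have Diff: "{x \<in> X. h x \<in> Y - A} = X - {x \<in> X. h x \<in> A}" for A
    using assms(2) by auto
  have mono: "{x \<in> X. h x \<in> B} \<in> p" if "{x \<in> X. h x \<in> A} \<in> p" "A \<subseteq> B" for A B
    by (rule filter_on_mono[OF p that(1)]) (use that(2) in auto)
  show ?thesis
    unfolding ultrafilter_on_def filter_image_def mem_Collect_eq
  proof (intro conjI allI impI)
    fix A assume "A \<subseteq> Y"
    show "A \<subseteq> Y \<and> {x \<in> X. h x \<in> A} \<in> p \<or> Y - A \<subseteq> Y \<and> {x \<in> X. h x \<in> Y - A} \<in> p"
      unfolding Diff using \<open>A \<subseteq> Y\<close> ultrafilter_on_Diff_iff[OF assms(1)] by auto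
  qed (use top mono filter_on_top[OF p] filter_on_empty[OF p] filter_on_Int[OF p] in \<open>auto simp: Int\<close>)
qed

section \<open>Addition of filters and idempotents\<close>

lemma shift_subset: "shift x A \<subseteq> \<nat>\<^sub>+"
  by (auto simp: shift_def)

lemma shift_shift: "shift y (shift x A) = shift (x + y) A"
  by (auto simp: shift_def add.assoc)

lemma shift_Int: "shift x (A \<inter> B) = shift x A \<inter> shift x B"
  by (auto simp: shift_def)

lemma shift_mono: "A \<subseteq> B \<Longrightarrow> shift x A \<subseteq> shift x B"
  by (auto simp: shift_def)

lemma beta_plus_iff: "A \<in> p \<oplus>\<^sub>\<beta> q \<longleftrightarrow> A \<subseteq> \<nat>\<^sub>+ \<and> {x \<in> \<nat>\<^sub>+. shift x A \<in> q} \<in> p"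
  by (simp add: beta_plus_def)

lemma beta_plus_mono:
  assumes "p \<subseteq> p'" "q \<subseteq> q'" "filter_on \<nat>\<^sub>+ p'"
  shows "p \<oplus>\<^sub>\<beta> q \<subseteq> p' \<oplus>\<^sub>\<beta> q'"
proof
  fix A assume A: "A \<in> p \<oplus>\<^sub>\<beta> q"
  have "{x \<in> \<nat>\<^sub>+. shift x A \<in> q'} \<in> p'"
    by (rule filter_on_mono[OF assms(3), of "{x \<in> \<nat>\<^sub>+. shift x A \<in> q}"])
      (use A assms in \<open>auto simp: beta_plus_iff\<close>)
  with A show "A \<in> p' \<oplus>\<^sub>\<beta> q'" by (simp add: beta_plus_iff)
qed

lemma beta_plus_assoc: "(p \<oplus>\<^sub>\<beta> q) \<oplus>\<^sub>\<beta> r = p \<oplus>\<^sub>\<beta> (q \<oplus>\<^sub>\<beta> r)"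
proof -
  have "shift z {x \<in> \<nat>\<^sub>+. shift x A \<in> r} = {x \<in> \<nat>\<^sub>+. shift x (shift z A) \<in> r}" for z A
    by (auto simp: shift_shift) (auto simp: shift_def)
  then show ?thesis
    using shift_subset by (auto simp: beta_plus_iff)
qed

lemma filter_on_beta_plus:
  assumes p: "filter_on \<nat>\<^sub>+ p" and q: "filter_on \<nat>\<^sub>+ q"
  shows "filter_on \<nat>\<^sub>+ (p \<oplus>\<^sub>\<beta> q)"
  unfolding filter_on_def
proof (intro conjI allI impI)
  have "shift x \<nat>\<^sub>+ = \<nat>\<^sub>+" "shift x {} = {}" for x by (auto simp: shift_def)
  then show "\<nat>\<^sub>+ \<in> p \<oplus>\<^sub>\<beta> q" "{} \<notin> p \<oplus>\<^sub>\<beta> q"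
    using filter_on_top[OF p] filter_on_top[OF q] filter_on_empty[OF p] filter_on_empty[OF q]
    by (simp_all add: beta_plus_iff flip: atLeast_def)
next
  fix A B assume "A \<in> p \<oplus>\<^sub>\<beta> q \<and> B \<in> p \<oplus>\<^sub>\<beta> q"
  then have AB: "A \<subseteq> \<nat>\<^sub>+" "{x \<in> \<nat>\<^sub>+. shift x A \<in> q} \<inter> {x \<in> \<nat>\<^sub>+. shift x B \<in> q} \<in> p"
    using filter_on_Int[OF p] by (auto simp: beta_plus_iff)
  have "{x \<in> \<nat>\<^sub>+. shift x (A \<inter> B) \<in> q} \<in> p"
    by (rule filter_on_mono[OF p AB(2)]) (auto simp: shift_Int filter_on_Int[OF q])
  with AB show "A \<inter> B \<in> p \<oplus>\<^sub>\<beta> q" by (auto simp: beta_plus_iff)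
next
  fix A B assume AB: "A \<in> p \<oplus>\<^sub>\<beta> q \<and> A \<subseteq> B \<and> B \<subseteq> \<nat>\<^sub>+"
  have "shift x B \<in> q" if "shift x A \<in> q" for x
    using AB by (intro filter_on_mono[OF q that] shift_mono shift_subset) auto
  then have sub: "{x \<in> \<nat>\<^sub>+. shift x A \<in> q} \<subseteq> {x \<in> \<nat>\<^sub>+. shift x B \<in> q}" by blast
  have "{x \<in> \<nat>\<^sub>+. shift x A \<in> q} \<in> p"
    using AB by (simp add: beta_plus_iff)
  then have "{x \<in> \<nat>\<^sub>+. shift x B \<in> q} \<in> p"
    by (rule filter_on_mono[OF p _ sub]) auto
  with AB show "B \<in> p \<oplus>\<^sub>\<beta> q" by (simp add: beta_plus_iff)
qed (auto simp: beta_plus_iff)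

text \<open>The Ellis-Numakura argument, read through the closed set \<open>T\<close> of
  ultrafilters above \<open>p\<close>: \<open>p \<subseteq> p + p\<close> makes \<open>T\<close> a
  subsemigroup, and maximality of \<open>p\<close> stands for minimality of \<open>T\<close>. For
  \<open>q\<close> in \<open>T\<close>, first \<open>T + q\<close> equals \<open>T\<close>, then
  \<open>{t \<in> T. t + q = q}\<close> equals \<open>T\<close>, which forces
  \<open>T = {q}\<close>.\<close>

lemma maximal_filter_idempotent:
  assumes p: "filter_on \<nat>\<^sub>+ p" and sub: "p \<subseteq> p \<oplus>\<^sub>\<beta> p"
    and maximal: "\<And>r. filter_on \<nat>\<^sub>+ r \<Longrightarrow> r \<subseteq> r \<oplus>\<^sub>\<beta> r \<Longrightarrow> p \<subseteq> r \<Longrightarrow> r = p"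
  shows "idempotent p"
proof -
  obtain q where uq: "ultrafilter_on \<nat>\<^sub>+ q" and pq: "p \<subseteq> q"
    using ultrafilter_on_extends[OF p] .
  have q: "filter_on \<nat>\<^sub>+ q" using uq by (simp add: ultrafilter_on_iff)
  have plus_q: "p \<oplus>\<^sub>\<beta> q = p"
  proof (rule maximal)
    show "filter_on \<nat>\<^sub>+ (p \<oplus>\<^sub>\<beta> q)" by (intro filter_on_beta_plus p q)
    show "p \<subseteq> p \<oplus>\<^sub>\<beta> q"
      using sub beta_plus_mono[OF subset_refl pq p] by blast
    \<comment> \<open>The assumption \<open>sub\<close>, used twice, gives three summands. The
      middle one is enlarged to \<open>q\<close>; adding \<open>q\<close> on the right and
      regrouping gives the condition for \<open>p + q\<close>.\<close>
    have "p \<subseteq> p \<oplus>\<^sub>\<beta> (p \<oplus>\<^sub>\<beta> p)"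
      using sub beta_plus_mono[OF subset_refl sub p] by blast
    also have "\<dots> \<subseteq> p \<oplus>\<^sub>\<beta> (q \<oplus>\<^sub>\<beta> p)"
      by (intro beta_plus_mono subset_refl pq p q)
    finally have "p \<oplus>\<^sub>\<beta> q \<subseteq> (p \<oplus>\<^sub>\<beta> (q \<oplus>\<^sub>\<beta> p)) \<oplus>\<^sub>\<beta> q"
      by (intro beta_plus_mono filter_on_beta_plus p q subset_refl)
    then show "p \<oplus>\<^sub>\<beta> q \<subseteq> (p \<oplus>\<^sub>\<beta> q) \<oplus>\<^sub>\<beta> (p \<oplus>\<^sub>\<beta> q)"
      by (simp add: beta_plus_assoc)
  qed
  \<comment> \<open>\<open>D A\<close> consists of the \<open>x\<close> with
    \<open>A \<in> x + q\<close>. An ultrafilter \<open>t\<close> contains \<open>D A\<close> for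
    all \<open>A \<in> q\<close> exactly when \<open>t + q = q\<close>, so \<open>r\<close> is the
    filter of the \<open>t\<close> above \<open>p\<close> with this property.\<close>
  define D where "D A = {x \<in> \<nat>\<^sub>+. shift x A \<in> q}" for A
  define r where "r = {B. B \<subseteq> \<nat>\<^sub>+ \<and> (\<exists>S\<in>D ` q. \<exists>C\<in>p. C \<inter> S \<subseteq> B)}"
  have D_subset: "D A \<subseteq> \<nat>\<^sub>+" for A by (auto simp: D_def)
  have D_Int: "D (A \<inter> B) = D A \<inter> D B" for A B
  proof -
    have "shift x (A \<inter> B) \<in> q \<longleftrightarrow> shift x A \<in> q \<and> shift x B \<in> q" for x
      unfolding shift_Int
      by (meson filter_on_Int filter_on_mono inf_le1 inf_le2 q shift_subset)
    then show ?thesis by (auto simp: D_def)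
  qed
  have r: "filter_on \<nat>\<^sub>+ r"
    unfolding r_def
  proof (rule filter_on_generated[OF p])
    fix S T assume "S \<in> D ` q" "T \<in> D ` q"
    then obtain A B where "A \<in> q" "B \<in> q" "S = D A" "T = D B" by blast
    then have "D (A \<inter> B) \<in> D ` q" "D (A \<inter> B) = S \<inter> T"
      using filter_on_Int[OF q] by (blast, simp add: D_Int)
    then show "\<exists>U\<in>D ` q. U \<subseteq> S \<inter> T" by blast
  next
    show "D ` q \<noteq> {}" using filter_on_top[OF q] by blast
  next
    fix S C assume "S \<in> D ` q" and C: "C \<in> p"
    then obtain A where A: "A \<in> q" "S = D A" by blast
    \<comment> \<open>Properness of \<open>r\<close>: if some \<open>C \<in> p\<close> missed
      \<open>D A\<close>, the complement of \<open>A\<close> would lie in \<open>p + q = p\<close>,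
      hence in \<open>q\<close> together with \<open>A\<close>.\<close>
    have *: "\<nat>\<^sub>+ - A \<notin> p \<oplus>\<^sub>\<beta> q"
      using plus_q pq A(1) ultrafilter_on_Diff_iff[OF uq] filter_on_subset[OF q] by blast
    show "C \<inter> S \<noteq> {}"
    proof
      assume empty: "C \<inter> S = {}"
      have "shift x (\<nat>\<^sub>+ - A) \<in> q" if "x \<in> C" for x
      proof -
        have "x \<in> \<nat>\<^sub>+" using that C filter_on_subset[OF p] by blast
        then have "shift x A \<notin> q" using empty that A by (auto simp: D_def)
        moreover have "shift x (\<nat>\<^sub>+ - A) = \<nat>\<^sub>+ - shift x A" by (auto simp: shift_def)
        ultimately show ?thesis
          using ultrafilter_on_Diff_iff[OF uq shift_subset] by simp
      qed
      then have "{x \<in> \<nat>\<^sub>+. shift x (\<nat>\<^sub>+ - A) \<in> q} \<in> p"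
        using filter_on_subset[OF p C] by (intro filter_on_mono[OF p C]) auto
      then show False using * by (auto simp: beta_plus_iff)
    qed
  qed
  have pr: "p \<subseteq> r"
    unfolding r_def using filter_on_subset[OF p] filter_on_top[OF q] by blast
  have D_r: "D A \<in> r" if "A \<in> q" for A
    unfolding r_def using D_subset that filter_on_top[OF p] by blast
  have "r \<subseteq> r \<oplus>\<^sub>\<beta> r"
  proof
    fix B assume "B \<in> r"
    then obtain A C where A: "A \<in> q" and C: "C \<in> p" and B: "B \<subseteq> \<nat>\<^sub>+" "C \<inter> D A \<subseteq> B"
      unfolding r_def by blast
    \<comment> \<open>For \<open>x \<in> D A\<close> the set \<open>shift x A\<close> is in
      \<open>q\<close>, and shifting \<open>D A\<close> by \<open>x\<close> gives
      \<open>D (shift x A)\<close>, again a generator of \<open>r\<close>.\<close>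
    have "D A \<subseteq> {x \<in> \<nat>\<^sub>+. shift x (D A) \<in> r}"
    proof
      fix x assume x: "x \<in> D A"
      have "shift x (D A) = D (shift x A)"
        by (auto simp: D_def shift_shift) (auto simp: shift_def)
      then show "x \<in> {x \<in> \<nat>\<^sub>+. shift x (D A) \<in> r}"
        using D_r x by (auto simp: D_def)
    qed
    then have "{x \<in> \<nat>\<^sub>+. shift x (D A) \<in> r} \<in> r"
      by (rule filter_on_mono[OF r D_r[OF A]]) auto
    then have "D A \<in> r \<oplus>\<^sub>\<beta> r"
      using D_subset by (simp add: beta_plus_iff)
    moreover have "C \<in> r \<oplus>\<^sub>\<beta> r"
      using C sub beta_plus_mono[OF pr pr r] by blast
    ultimately show "B \<in> r \<oplus>\<^sub>\<beta> r"
      using filter_on_Int filter_on_mono B filter_on_beta_plus[OF r r] by meson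
  qed
  from maximal[OF r this pr] have "r = p" .
  have "q \<subseteq> p \<oplus>\<^sub>\<beta> q"
    using D_r filter_on_subset[OF q] unfolding \<open>r = p\<close> by (auto simp: beta_plus_iff D_def)
  then have "q = p" using pq plus_q by blast
  then show ?thesis
    using uq plus_q by (simp add: idempotent_def beta_N_def)
qed

text \<open>Zorn's lemma for the filters \<open>q\<close> above \<open>p\<close> with
  \<open>q \<subseteq> q + q\<close>; this inclusion passes to unions of chains because the sum is
  monotone in both arguments.\<close>

lemma idempotent_extends:
  assumes "filter_on \<nat>\<^sub>+ p" "p \<subseteq> p \<oplus>\<^sub>\<beta> p"
  obtains q where "idempotent q" "p \<subseteq> q"
proof -
  define S where "S = {q. filter_on \<nat>\<^sub>+ q \<and> q \<subseteq> q \<oplus>\<^sub>\<beta> q \<and> p \<subseteq> q}"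
  have "\<exists>q\<in>S. \<forall>r\<in>S. q \<subseteq> r \<longrightarrow> r = q"
  proof (rule subset_Zorn_nonempty)
    show "S \<noteq> {}" using assms by (auto simp: S_def)
    fix C assume C: "C \<noteq> {}" "subset.chain S C"
    then have U: "filter_on \<nat>\<^sub>+ (\<Union>C)"
      by (intro filter_on_Union_chain) (auto simp: subset_chain_def S_def)
    have "q \<subseteq> \<Union>C \<oplus>\<^sub>\<beta> \<Union>C" if "q \<in> C" for q
    proof -
      have "q \<subseteq> q \<oplus>\<^sub>\<beta> q" using that C by (auto simp: subset_chain_def S_def)
      also have "\<dots> \<subseteq> \<Union>C \<oplus>\<^sub>\<beta> \<Union>C"
        using that by (intro beta_plus_mono U) auto
      finally show ?thesis .
    qed
    moreover have "p \<subseteq> \<Union>C" using C unfolding subset_chain_def S_def by blast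
    ultimately show "\<Union>C \<in> S"
      using U by (auto simp: S_def)
  qed
  then obtain q where q: "q \<in> S" and maximal: "\<And>r. r \<in> S \<Longrightarrow> q \<subseteq> r \<Longrightarrow> r = q" by blast
  have "idempotent q"
  proof (rule maximal_filter_idempotent)
    fix r assume "filter_on \<nat>\<^sub>+ r" "r \<subseteq> r \<oplus>\<^sub>\<beta> r" "q \<subseteq> r"
    with q show "r = q" by (intro maximal) (auto simp: S_def)
  qed (use q in \<open>simp_all add: S_def\<close>)
  then show ?thesis using that q by (simp add: S_def)
qed

section \<open>J-sets\<close>

lemma J_set_mono: "J_set A \<Longrightarrow> A \<subseteq> B \<Longrightarrow> B \<subseteq> \<nat>\<^sub>+ \<Longrightarrow> J_set B"
  unfolding J_set_def by (meson subsetD)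

text \<open>The same \<open>H\<close> serves, with \<open>x\<close> absorbed in the constant
  \<open>a\<close>.\<close>

lemma J_set_translate:
  assumes "J_set (shift x A)" "A \<subseteq> \<nat>\<^sub>+"
  shows "J_set A"
  unfolding J_set_def
proof (intro conjI ballI assms(2))
  fix F assume "F \<in> \<P>\<^sub>f (\<nat>\<^sub>+ \<rightarrow> \<nat>\<^sub>+)"
  with assms(1) obtain a H where "a \<in> \<nat>\<^sub>+" "H \<in> \<P>\<^sub>f \<nat>\<^sub>+"
    "\<forall>f\<in>F. a + (\<Sum>t\<in>H. f t) \<in> shift x A"
    unfolding J_set_def by blast
  then show "\<exists>a\<in>\<nat>\<^sub>+. \<exists>H\<in>\<P>\<^sub>f \<nat>\<^sub>+. \<forall>f\<in>F. a + (\<Sum>t\<in>H. f t) \<in> A"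
    by (intro bexI[of _ "x + a"] bexI[of _ H]) (auto simp: shift_def add.assoc)
qed

section \<open>Dilates of J-sets\<close>

text \<open>Pigeonhole on the vectors of residues modulo \<open>s\<close>: one vector occurs at
  infinitely many \<open>t\<close>, and over a block of \<open>s\<close> such indices each
  \<open>f\<close> sums \<open>s\<close> equal residues.\<close>

lemma blocks_with_divisible_sums:
  fixes F :: "(nat \<Rightarrow> nat) set" and s :: nat
  assumes "finite F" "s \<ge> 1"
  obtains G :: "nat \<Rightarrow> nat set" where "\<And>k. G k \<in> \<P>\<^sub>f \<nat>\<^sub>+" "disjoint_family_on G UNIV"
    "\<And>f k. f \<in> F \<Longrightarrow> s dvd (\<Sum>t\<in>G k. f t)"
proof -
  \<comment> \<open>\<open>restrict\<close> makes the residue vectors extensional, so that only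
    finitely many are possible.\<close>
  let ?res = "\<lambda>t. restrict (\<lambda>f. f t mod s) F"
  have "?res ` \<nat>\<^sub>+ \<subseteq> F \<rightarrow>\<^sub>E {..<s}" using assms(2) by auto
  then have "finite (?res ` \<nat>\<^sub>+)"
    using finite_PiE[OF assms(1)] by (rule finite_subset) simp
  then obtain t0 where inf: "infinite {t \<in> \<nat>\<^sub>+. ?res t = ?res t0}"
    using pigeonhole_infinite[OF infinite_Ici, of ?res 1] by blast
  define S where "S = {t \<in> \<nat>\<^sub>+. ?res t = ?res t0}"
  define G where "G k = enumerate S ` {k * s..<Suc k * s}" for k
  have S: "infinite S" using inf by (simp add: S_def)
  have inj: "inj_on (enumerate S) I" for I
    using strict_mono_imp_inj_on[OF strict_mono_enumerate[OF S]] inj_on_subset by blast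
  have G_S: "G k \<subseteq> S" for k using enumerate_in_set[OF S] by (auto simp: G_def)
  show ?thesis
  proof
    fix k
    show "G k \<in> \<P>\<^sub>f \<nat>\<^sub>+"
      using G_S[of k] assms(2) by (auto simp: fin_nonempty_def S_def) (auto simp: G_def)
  next
    \<comment> \<open>Division by \<open>s\<close> recovers the number of the block from the
      position in the enumeration.\<close>
    have "enumerate S i \<noteq> enumerate S j"
      if "i \<in> {k * s..<Suc k * s}" "j \<in> {l * s..<Suc l * s}" "k \<noteq> l" for i j k l
    proof -
      have "i div s = k" "j div s = l"
        using that by (auto intro!: div_nat_eqI simp: mult.commute)
      then show ?thesis using that(3) inj[of UNIV] by (auto dest: injD)
    qed
    then show "disjoint_family_on G UNIV"
      by (fastforce simp: disjoint_family_on_def G_def)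
  next
    fix f k assume f: "f \<in> F"
    have "f t mod s = f t0 mod s" if "t \<in> G k" for t
    proof -
      have "?res t = ?res t0" using that G_S[of k] by (auto simp: S_def)
      from fun_cong[OF this, of f] f show ?thesis by simp
    qed
    then have "(\<Sum>t\<in>G k. f t) mod s = (\<Sum>t\<in>G k. f t0 mod s) mod s"
      by (subst mod_sum_eq[symmetric]) simp
    also have "(\<Sum>t\<in>G k. f t0 mod s) = s * (f t0 mod s)"
      using card_image[OF inj] by (simp add: G_def)
    finally show "s dvd (\<Sum>t\<in>G k. f t)" by (simp add: mod_eq_0_iff_dvd)
  qed
qed

text \<open>The block sums divided by \<open>s\<close> form positive sequences \<open>g f\<close>,
  to which the J-property of \<open>B\<close> applies. Multiplying by \<open>s\<close> turns
  \<open>a\<close> into \<open>s * a\<close> and \<open>H\<close> into a union of blocks.\<close>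

lemma J_set_dilate:
  assumes B: "J_set B" and s: "s \<ge> 1"
  shows "J_set ((*) s ` B)"
  unfolding J_set_def
proof (intro conjI ballI)
  show "(*) s ` B \<subseteq> \<nat>\<^sub>+" using B s by (force simp: J_set_def)
  fix F assume F: "F \<in> \<P>\<^sub>f (\<nat>\<^sub>+ \<rightarrow> \<nat>\<^sub>+)"
  then have "finite F" by (simp add: fin_nonempty_def)
  then obtain G :: "nat \<Rightarrow> nat set" where G: "\<And>k. G k \<in> \<P>\<^sub>f \<nat>\<^sub>+" "disjoint_family_on G UNIV"
    and dvd: "\<And>f k. f \<in> F \<Longrightarrow> s dvd (\<Sum>t\<in>G k. f t)"
    using blocks_with_divisible_sums[OF _ s] by blast
  define g where "g f k = (\<Sum>t\<in>G k. f t) div s" for f k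
  have g: "(\<Sum>t\<in>G k. f t) = s * g f k" if "f \<in> F" for f k
    using dvd[OF that] by (simp add: g_def)
  have "g f k \<ge> 1" if "f \<in> F" for f k
  proof -
    have "\<forall>t\<in>G k. f t \<ge> 1"
      using G(1)[of k] F that by (auto simp: fin_nonempty_def Pi_iff subset_iff)
    moreover have "finite (G k)" "G k \<noteq> {}" using G(1)[of k] by (auto simp: fin_nonempty_def)
    ultimately have "(\<Sum>t\<in>G k. f t) > 0"
      by (intro sum_pos) (auto simp: Suc_le_eq)
    then show ?thesis unfolding g[OF that] by simp
  qed
  then have "g ` F \<in> \<P>\<^sub>f (\<nat>\<^sub>+ \<rightarrow> \<nat>\<^sub>+)"
    using F by (auto simp: fin_nonempty_def)
  with B have "\<exists>a\<in>\<nat>\<^sub>+. \<exists>H\<in>\<P>\<^sub>f \<nat>\<^sub>+. \<forall>h\<in>g ` F. a + (\<Sum>k\<in>H. h k) \<in> B"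
    unfolding J_set_def by (elim conjE bspec)
  then obtain a H where aH: "a \<in> \<nat>\<^sub>+" "H \<in> \<P>\<^sub>f \<nat>\<^sub>+"
    "\<forall>f\<in>F. a + (\<Sum>k\<in>H. g f k) \<in> B"
    by auto
  have "s * a + (\<Sum>t\<in>(\<Union>k\<in>H. G k). f t) = s * (a + (\<Sum>k\<in>H. g f k))" if "f \<in> F" for f
  proof -
    have "(\<Sum>t\<in>(\<Union>k\<in>H. G k). f t) = (\<Sum>k\<in>H. \<Sum>t\<in>G k. f t)"
      using aH G by (intro sum.UNION_disjoint)
        (auto simp: fin_nonempty_def disjoint_family_on_def)
    then show ?thesis using g[OF that] by (simp add: sum_distrib_left distrib_left)
  qed
  moreover have "(\<Union>k\<in>H. G k) \<in> \<P>\<^sub>f \<nat>\<^sub>+"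
    using aH G(1) by (auto simp: fin_nonempty_def subset_iff)
  moreover have "s * a \<in> \<nat>\<^sub>+" using aH s by simp
  ultimately show "\<exists>a\<in>\<nat>\<^sub>+. \<exists>H\<in>\<P>\<^sub>f \<nat>\<^sub>+. \<forall>f\<in>F. a + (\<Sum>t\<in>H. f t) \<in> (*) s ` B"
    using aH(3) by (metis imageI)
qed

text \<open>Membership of \<open>A\<close> in the translate means \<open>shift x A \<in> p\<close>,
  so \<open>J_set_translate\<close> applies.\<close>

lemma J_N_translate:
  assumes "p \<in> J_N"
  shows "filter_image \<nat>\<^sub>+ ((+) x) \<nat>\<^sub>+ p \<in> J_N"
proof -
  have "{y \<in> \<nat>\<^sub>+. x + y \<in> A} = shift x A" for A by (simp add: shift_def)
  moreover have "ultrafilter_on \<nat>\<^sub>+ (filter_image \<nat>\<^sub>+ ((+) x) \<nat>\<^sub>+ p)"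
    by (rule ultrafilter_on_image) (use assms in \<open>auto simp: J_N_def beta_N_def\<close>)
  ultimately show ?thesis
    using assms J_set_translate by (auto simp: J_N_def beta_N_def filter_image_def)
qed

text \<open>A member \<open>A\<close> of the dilate contains \<open>s\<close> times the J-set
  \<open>{y \<in> \<nat>\<^sub>+. s * y \<in> A}\<close>.\<close>

lemma J_N_dilate:
  assumes "p \<in> J_N" "s \<ge> 1"
  shows "filter_image \<nat>\<^sub>+ ((*) s) \<nat>\<^sub>+ p \<in> J_N"
proof -
  have "J_set A" if "A \<subseteq> \<nat>\<^sub>+" "J_set {y \<in> \<nat>\<^sub>+. s * y \<in> A}" for A
    by (rule J_set_mono[OF J_set_dilate[OF that(2) assms(2)]]) (use that in auto)
  moreover have "ultrafilter_on \<nat>\<^sub>+ (filter_image \<nat>\<^sub>+ ((*) s) \<nat>\<^sub>+ p)"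
    by (rule ultrafilter_on_image) (use assms in \<open>auto simp: J_N_def beta_N_def\<close>)
  ultimately show ?thesis
    using assms by (auto simp: J_N_def beta_N_def filter_image_def)
qed

text \<open>Multiplication by \<open>s\<close> respects addition: pulling back along it turns a
  shift by \<open>s * z\<close> into a shift by \<open>z\<close>.\<close>

lemma idempotent_dilate:
  assumes "idempotent p" "s \<ge> 1"
  shows "idempotent (filter_image \<nat>\<^sub>+ ((*) s) \<nat>\<^sub>+ p)"
proof -
  define q where "q = filter_image \<nat>\<^sub>+ ((*) s) \<nat>\<^sub>+ p"
  have "ultrafilter_on \<nat>\<^sub>+ q"
    unfolding q_def
    by (rule ultrafilter_on_image) (use assms in \<open>auto simp: idempotent_def beta_N_def\<close>)
  moreover have "A \<in> q \<oplus>\<^sub>\<beta> q \<longleftrightarrow> A \<in> q" for A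
  proof (cases "A \<subseteq> \<nat>\<^sub>+")
    case True
    have "shift (s * z) A \<in> q \<longleftrightarrow> shift z {y \<in> \<nat>\<^sub>+. s * y \<in> A} \<in> p" if "z \<in> \<nat>\<^sub>+" for z
    proof -
      have "{y \<in> \<nat>\<^sub>+. s * y \<in> shift (s * z) A} = shift z {y \<in> \<nat>\<^sub>+. s * y \<in> A}"
        using assms(2) by (auto simp: shift_def distrib_left)
      then show ?thesis using shift_subset by (simp add: q_def filter_image_def)
    qed
    then have "{z \<in> \<nat>\<^sub>+. s * z \<in> {x \<in> \<nat>\<^sub>+. shift x A \<in> q}} =
        {z \<in> \<nat>\<^sub>+. shift z {y \<in> \<nat>\<^sub>+. s * y \<in> A} \<in> p}"
      using assms(2) by auto
    then have "A \<in> q \<oplus>\<^sub>\<beta> q \<longleftrightarrow> {y \<in> \<nat>\<^sub>+. s * y \<in> A} \<in> p \<oplus>\<^sub>\<beta> p"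
      using True by (subst q_def) (auto simp: beta_plus_iff filter_image_def)
    then show ?thesis
      using assms(1) True by (simp add: idempotent_def q_def filter_image_def)
  qed (auto simp: beta_plus_iff q_def filter_image_def)
  ultimately show ?thesis
    unfolding q_def by (auto simp: idempotent_def beta_N_def)
qed

text \<open>The additive hypothesis on \<open>A\<close>, applied to the dilate of \<open>p\<close>,
  gives control over products.\<close>

lemma C_star_set_dilate:
  assumes "C_star_set A" "idempotent p" "p \<in> J_N" "s \<ge> 1"
  shows "{m \<in> \<nat>\<^sub>+. s * m \<in> A} \<in> p"
proof -
  have "A \<in> filter_image \<nat>\<^sub>+ ((*) s) \<nat>\<^sub>+ p"
    using assms idempotent_dilate J_N_dilate unfolding C_star_set_def by blast
  then show ?thesis by (simp add: filter_image_def)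
qed

section \<open>Almost minimal sequences\<close>

lemma FS_antimono: "m \<le> n \<Longrightarrow> FS x n \<subseteq> FS x m"
  unfolding FS_def by (blast intro: order_trans)

text \<open>Index sets beyond \<open>Max F\<close> can be joined to \<open>F\<close>.\<close>

lemma FS_shift:
  assumes "y \<in> FS x m"
  obtains k where "k \<in> \<nat>\<^sub>+" "\<And>z. z \<in> FS x k \<Longrightarrow> y + z \<in> FS x m"
proof -
  from assms obtain F where F: "y = (\<Sum>n\<in>F. x n)" "F \<in> \<P>\<^sub>f \<nat>\<^sub>+" "m \<le> Min F"
    by (auto simp: FS_def)
  show ?thesis
  proof (rule that[of "Suc (Max F)"])
    fix z assume "z \<in> FS x (Suc (Max F))"
    then obtain G where G: "z = (\<Sum>n\<in>G. x n)" "G \<in> \<P>\<^sub>f \<nat>\<^sub>+" "Suc (Max F) \<le> Min G"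
      by (auto simp: FS_def)
    have fin: "finite F" "finite G" "F \<noteq> {}" "G \<noteq> {}"
      using F G by (auto simp: fin_nonempty_def)
    then have less: "a < b" if "a \<in> F" "b \<in> G" for a b
      using G(3) Max_ge[of F a] Min_le[of G b] that by linarith
    then have "y + z = (\<Sum>n\<in>F \<union> G. x n)"
      using F G fin by (subst sum.union_disjoint) auto
    moreover have "F \<union> G \<in> \<P>\<^sub>f \<nat>\<^sub>+" using F G by (auto simp: fin_nonempty_def)
    moreover have "m \<le> Min (F \<union> G)"
    proof -
      have "Min F < b" if "b \<in> G" for b using less[OF Min_in that] fin by blast
      from this[OF Min_in[OF fin(2,4)]] show ?thesis using F(3) fin by (simp add: Min_Un)
    qed
    ultimately show "y + z \<in> FS x m" unfolding FS_def by blast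
  qed simp
qed

text \<open>An idempotent above the filter \<open>\<phi>\<close> will do: it contains the tails
  \<open>FS x m\<close>, and it lies in \<open>J_N\<close> because \<open>\<phi>\<close> contains
  the complement of every set of positive integers that is not a J-set.\<close>

lemma almost_minimal_idempotent:
  assumes "almost_minimal x"
  obtains p where "idempotent p" "p \<in> J_N" "\<And>m. m \<in> \<nat>\<^sub>+ \<Longrightarrow> FS x m \<in> p"
proof -
  have ultra: "ultrafilter_on \<nat>\<^sub>+ p" and filter: "filter_on \<nat>\<^sub>+ p" if "p \<in> J_N" for p
    using that by (auto simp: J_N_def beta_N_def ultrafilter_on_iff)
  obtain r where r: "r \<in> J_N" "\<And>m. m \<in> \<nat>\<^sub>+ \<Longrightarrow> FS x m \<in> r"
    using assms by (auto simp: almost_minimal_def cl_def)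
  have FS_pos: "FS x m \<subseteq> \<nat>\<^sub>+" if "m \<in> \<nat>\<^sub>+" for m
    using r that filter_on_subset[OF filter] by blast
  \<comment> \<open>\<open>A \<in> \<phi>\<close> says that \<open>cl A\<close> contains
    \<open>cl (FS x m) \<inter> J_N\<close> for some \<open>m\<close>. Asking for a single
    \<open>m\<close>, in place of the intersection over all \<open>m\<close>, takes over the role of
    compactness.\<close>
  define \<phi> where "\<phi> = {A. A \<subseteq> \<nat>\<^sub>+ \<and> (\<exists>m\<in>\<nat>\<^sub>+. \<forall>p\<in>J_N. FS x m \<in> p \<longrightarrow> A \<in> p)}"
  have \<phi>I: "A \<in> \<phi>"
    if "A \<subseteq> \<nat>\<^sub>+" "m \<in> \<nat>\<^sub>+" "\<And>p. p \<in> J_N \<Longrightarrow> FS x m \<in> p \<Longrightarrow> A \<in> p" for A m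
    using that unfolding \<phi>_def by blast
  have FS_\<phi>: "FS x m \<in> \<phi>" if "m \<in> \<nat>\<^sub>+" for m
    using that FS_pos by (auto simp: \<phi>_def)
  have \<phi>: "filter_on \<nat>\<^sub>+ \<phi>"
    unfolding filter_on_def
  proof (intro conjI allI impI)
    show "\<phi> \<subseteq> Pow \<nat>\<^sub>+" by (auto simp: \<phi>_def)
    show "\<nat>\<^sub>+ \<in> \<phi>" using filter_on_top[OF filter] by (auto simp: \<phi>_def)
    show "{} \<notin> \<phi>" using r filter_on_empty[OF filter] by (auto simp: \<phi>_def)
  next
    fix A B assume AB: "A \<in> \<phi> \<and> B \<in> \<phi>"
    from AB obtain m where A: "A \<subseteq> \<nat>\<^sub>+" "m \<in> \<nat>\<^sub>+" "\<And>p. p \<in> J_N \<Longrightarrow> FS x m \<in> p \<Longrightarrow> A \<in> p"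
      by (auto simp: \<phi>_def)
    from AB obtain n where B: "n \<in> \<nat>\<^sub>+" "\<And>p. p \<in> J_N \<Longrightarrow> FS x n \<in> p \<Longrightarrow> B \<in> p"
      by (auto simp: \<phi>_def)
    have "A \<inter> B \<in> p" if p: "p \<in> J_N" "FS x (max m n) \<in> p" for p
    proof -
      have "FS x m \<in> p" "FS x n \<in> p"
        using filter_on_mono[OF filter[OF p(1)] p(2) FS_antimono FS_pos] A(2) B(1) by auto
      then show ?thesis
        by (intro filter_on_Int[OF filter[OF p(1)]] A(3) B(2) p(1))
    qed
    then show "A \<inter> B \<in> \<phi>" using A(1,2) by (intro \<phi>I[of _ "max m n"]) auto
  next
    fix A B assume AB: "A \<in> \<phi> \<and> A \<subseteq> B \<and> B \<subseteq> \<nat>\<^sub>+"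
    then obtain m where m: "m \<in> \<nat>\<^sub>+" "\<And>p. p \<in> J_N \<Longrightarrow> FS x m \<in> p \<Longrightarrow> A \<in> p"
      by (auto simp: \<phi>_def)
    show "B \<in> \<phi>"
    proof (rule \<phi>I[OF _ m(1)])
      fix p assume p: "p \<in> J_N" "FS x m \<in> p"
      show "B \<in> p"
        using AB by (intro filter_on_mono[OF filter[OF p(1)] m(2)[OF p]]) auto
    qed (use AB in blast)
  qed
  have "\<phi> \<subseteq> \<phi> \<oplus>\<^sub>\<beta> \<phi>"
  proof
    fix A assume "A \<in> \<phi>"
    then obtain m where A: "A \<subseteq> \<nat>\<^sub>+" "m \<in> \<nat>\<^sub>+" "\<And>p. p \<in> J_N \<Longrightarrow> FS x m \<in> p \<Longrightarrow> A \<in> p"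
      by (auto simp: \<phi>_def)
    \<comment> \<open>If \<open>p \<in> J_N\<close> contains \<open>FS x k\<close>, its translate by
      \<open>y\<close> contains \<open>FS x m\<close> and stays in \<open>J_N\<close>, hence
      contains \<open>A\<close>.\<close>
    have "shift y A \<in> \<phi>" if y: "y \<in> FS x m" for y
    proof -
      from y obtain k where k: "k \<in> \<nat>\<^sub>+" "\<And>z. z \<in> FS x k \<Longrightarrow> y + z \<in> FS x m"
        using FS_shift by blast
      have "shift y A \<in> p" if p: "p \<in> J_N" "FS x k \<in> p" for p
      proof -
        have "{z \<in> \<nat>\<^sub>+. y + z \<in> FS x m} \<in> p"
          using FS_pos[OF k(1)] k(2) by (intro filter_on_mono[OF filter[OF p(1)] p(2)]) auto
        then have "FS x m \<in> filter_image \<nat>\<^sub>+ ((+) y) \<nat>\<^sub>+ p"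
          using FS_pos[OF A(2)] unfolding filter_image_def by blast
        then have "A \<in> filter_image \<nat>\<^sub>+ ((+) y) \<nat>\<^sub>+ p"
          by (rule A(3)[OF J_N_translate[OF p(1)]])
        then show ?thesis by (simp add: filter_image_def shift_def)
      qed
      then show ?thesis by (rule \<phi>I[OF shift_subset k(1)])
    qed
    then have "{y \<in> \<nat>\<^sub>+. shift y A \<in> \<phi>} \<in> \<phi>"
      using FS_pos A by (intro filter_on_mono[OF \<phi> FS_\<phi>[OF A(2)]]) auto
    with A show "A \<in> \<phi> \<oplus>\<^sub>\<beta> \<phi>" by (simp add: beta_plus_iff)
  qed
  then obtain q where q: "idempotent q" "\<phi> \<subseteq> q"
    using idempotent_extends[OF \<phi>] by blast
  then have uq: "ultrafilter_on \<nat>\<^sub>+ q" by (simp add: idempotent_def beta_N_def)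
  have "J_set A" if "A \<in> q" for A
  proof (rule ccontr)
    assume "\<not> J_set A"
    have sub: "A \<subseteq> \<nat>\<^sub>+" using uq that by (auto simp: ultrafilter_on_def)
    have "\<nat>\<^sub>+ - A \<in> p" if "p \<in> J_N" for p
      using ultrafilter_on_Diff_iff[OF ultra[OF that] sub] \<open>\<not> J_set A\<close> that
      by (auto simp: J_N_def)
    then have "\<nat>\<^sub>+ - A \<in> \<phi>" by (auto simp: \<phi>_def)
    then show False
      using q(2) that ultrafilter_on_Diff_iff[OF uq sub] by blast
  qed
  then have "q \<in> J_N" using uq by (auto simp: J_N_def beta_N_def)
  with q FS_\<phi> show ?thesis using that by blast
qed

section \<open>The star set and the recursive choice of blocks\<close>

text \<open>By idempotence every \<open>C \<in> p\<close> has its star in \<open>p\<close>. The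
  second claim is the case \<open>C = shift x A\<close>, whose star is
  \<open>shift x B\<close>.\<close>

lemma idempotent_star:
  assumes "idempotent p" "A \<in> p"
  defines "B \<equiv> {x \<in> A. shift x A \<in> p}"
  shows "B \<in> p" and "x \<in> B \<Longrightarrow> shift x B \<in> p"
proof -
  have p: "filter_on \<nat>\<^sub>+ p"
    using assms(1) by (simp add: idempotent_def beta_N_def ultrafilter_on_iff)
  have star: "{y \<in> \<nat>\<^sub>+. shift y C \<in> p} \<inter> C \<in> p" if "C \<in> p" for C
    using that assms(1) filter_on_Int[OF p] unfolding idempotent_def
    by (metis beta_plus_iff)
  have "B = {y \<in> \<nat>\<^sub>+. shift y A \<in> p} \<inter> A"
    using filter_on_subset[OF p assms(2)] by (auto simp: B_def)
  then show "B \<in> p" using star[OF assms(2)] by simp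
  assume "x \<in> B"
  then have "shift x A \<in> p" by (simp add: B_def)
  moreover have "{y \<in> \<nat>\<^sub>+. shift y (shift x A) \<in> p} \<inter> shift x A = shift x B"
    unfolding shift_shift by (auto simp: B_def shift_def)
  ultimately show "shift x B \<in> p" using star by metis
qed

theorem theorem2p10:
  fixes x :: "nat \<Rightarrow> nat" and A :: "nat set"
  assumes "almost_minimal x" and "C_star_set A"
  shows "\<exists>y. sum_subsystem y x \<and> FS y 1 \<union> FP y 1 \<subseteq> A"
proof -
  obtain p where p: "idempotent p" "p \<in> J_N" and FS_p: "\<And>m. m \<in> \<nat>\<^sub>+ \<Longrightarrow> FS x m \<in> p"
    using almost_minimal_idempotent[OF assms(1)] by blast
  have filter: "filter_on \<nat>\<^sub>+ p"
    using p(1) by (simp add: idempotent_def beta_N_def ultrafilter_on_iff)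
  have A: "A \<in> p" using assms(2) p by (simp add: C_star_set_def)
  define B where "B = {a \<in> A. shift a A \<in> p}"
  note B = idempotent_star[OF p(1) A, folded B_def]
  have B_pos: "B \<subseteq> \<nat>\<^sub>+" using filter_on_subset[OF filter B(1)] .
  define \<sigma> where "\<sigma> H = (\<Sum>t\<in>H. x t)" for H
  \<comment> \<open>\<open>R\<close> may follow the blocks \<open>H k\<close> with
    \<open>k < n\<close>. The case \<open>F = {}\<close> puts \<open>\<sigma> R\<close> itself in
    \<open>B\<close>. Sums must stay in \<open>B\<close> so that further terms can be added; for
    products \<open>A\<close> suffices, since each new factor is drawn from sets
    \<open>{m. s * m \<in> A}\<close>.\<close>
  define good where "good H n R \<longleftrightarrow> R \<in> \<P>\<^sub>f \<nat>\<^sub>+ \<and> (\<forall>k<n. Max (H k) < Min R) \<and>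
      (\<forall>F. F \<subseteq> {..<n} \<longrightarrow> (\<Sum>k\<in>F. \<sigma> (H k)) + \<sigma> R \<in> B \<and> (\<Prod>k\<in>F. \<sigma> (H k)) * \<sigma> R \<in> A)"
    for H :: "nat \<Rightarrow> nat set" and n R
  have "\<exists>H. \<forall>n. good H n (H n)"
  \<comment> \<open>Two goals: \<open>good H n\<close> depends only on the values of
    \<open>H\<close> below \<open>n\<close>, and some \<open>R\<close> is always available.\<close>
  proof (rule dependent_wellorder_choice)
    fix R and H H' :: "nat \<Rightarrow> nat set" and n
    assume eq: "\<And>k. k < n \<Longrightarrow> H k = H' k"
    have "(\<Sum>k\<in>F. \<sigma> (H k)) = (\<Sum>k\<in>F. \<sigma> (H' k))" "(\<Prod>k\<in>F. \<sigma> (H k)) = (\<Prod>k\<in>F. \<sigma> (H' k))"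
      if "F \<subseteq> {..<n}" for F
      using that eq by (auto intro!: sum.cong prod.cong)
    then show "good H n R = good H' n R"
      unfolding good_def using eq by simp
  next
    fix n and H :: "nat \<Rightarrow> nat set"
    assume IH: "\<And>k. k < n \<Longrightarrow> good H k (H k)"
    let ?S = "\<lambda>F. shift (\<Sum>k\<in>F. \<sigma> (H k)) B"
    let ?P = "\<lambda>F. {m \<in> \<nat>\<^sub>+. (\<Prod>k\<in>F. \<sigma> (H k)) * m \<in> A}"
    \<comment> \<open>\<open>Max F\<close> is the last stage in \<open>F\<close>, and goodness
      there, with the rest of \<open>F\<close> as index set, puts the sum over \<open>F\<close> in
      \<open>B\<close>.\<close>
    have S: "?S F \<in> p" if "F \<subseteq> {..<n}" for F
    proof (cases "F = {}")
      case True
      then have "?S F = B" using B_pos by (auto simp: shift_def)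
      with B show ?thesis by simp
    next
      case False
      have fin: "finite F" using that finite_subset by blast
      have m: "Max F \<in> F" using Max_in fin False by blast
      then have "good H (Max F) (H (Max F))" using IH that by blast
      moreover have "F - {Max F} \<subseteq> {..<Max F}"
        using fin by (auto simp: order_less_le)
      ultimately have "(\<Sum>k\<in>F - {Max F}. \<sigma> (H k)) + \<sigma> (H (Max F)) \<in> B"
        unfolding good_def by blast
      then have "(\<Sum>k\<in>F. \<sigma> (H k)) \<in> B"
        by (simp add: sum.remove[OF fin m] add.commute)
      then show ?thesis by (rule B(2))
    qed
    \<comment> \<open>The dilation factor only has to be positive, which holds as all earlier terms
      lie in \<open>B\<close>.\<close>
    have P: "?P F \<in> p" if "F \<subseteq> {..<n}" for F
    proof (rule C_star_set_dilate[OF assms(2) p])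
      have "\<sigma> (H k) \<in> B" if "k < n" for k
        using IH[OF that] unfolding good_def by (metis add_0 empty_subsetI sum.empty)
      then have "\<sigma> (H k) \<ge> 1" if "k \<in> F" for k
        using B_pos that \<open>F \<subseteq> {..<n}\<close> by fastforce
      then show "(\<Prod>k\<in>F. \<sigma> (H k)) \<ge> 1" by (intro prod_ge_1)
    qed
    \<comment> \<open>\<open>insert 0\<close> provides for \<open>n = 0\<close>; \<open>Suc\<close>
      makes the bound strict and \<open>l\<close> positive.\<close>
    define l where "l = Suc (Max (insert 0 ((\<lambda>k. Max (H k)) ` {..<n})))"
    have l: "Max (H k) < l" if "k < n" for k
      unfolding l_def less_Suc_eq_le using that by (intro Max_ge) auto
    \<comment> \<open>There is one condition for each of the finitely many \<open>F\<close>; an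
      element of \<open>FS x l\<close> meeting them all is the sum over a block beyond the earlier
      ones.\<close>
    have "\<nat>\<^sub>+ \<inter> (\<Inter>F\<in>Pow {..<n}. ?S F \<inter> ?P F) \<in> p"
      by (rule filter_on_INT[OF filter]) (use S P filter_on_Int[OF filter] in blast)+
    then have "FS x l \<inter> (\<nat>\<^sub>+ \<inter> (\<Inter>F\<in>Pow {..<n}. ?S F \<inter> ?P F)) \<in> p"
      by (rule filter_on_Int[OF filter, rotated]) (simp add: FS_p l_def)
    then have "FS x l \<inter> (\<nat>\<^sub>+ \<inter> (\<Inter>F\<in>Pow {..<n}. ?S F \<inter> ?P F)) \<noteq> {}"
      using filter_on_empty[OF filter] by metis
    then obtain y where y: "y \<in> FS x l" "\<And>F. F \<subseteq> {..<n} \<Longrightarrow> y \<in> ?S F \<and> y \<in> ?P F"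
      by blast
    from y(1) obtain R where R: "y = \<sigma> R" "R \<in> \<P>\<^sub>f \<nat>\<^sub>+" "l \<le> Min R"
      by (auto simp: FS_def \<sigma>_def)
    have "good H n R"
      unfolding good_def
    proof (intro conjI allI impI)
      show "R \<in> \<P>\<^sub>f \<nat>\<^sub>+" by (fact R(2))
      show "Max (H k) < Min R" if "k < n" for k using l[OF that] R(3) by simp
      fix F assume "F \<subseteq> {..<n}"
      from y(2)[OF this] show "(\<Sum>k\<in>F. \<sigma> (H k)) + \<sigma> R \<in> B" "(\<Prod>k\<in>F. \<sigma> (H k)) * \<sigma> R \<in> A"
        by (simp_all add: shift_def R(1))
    qed
    then show "\<exists>R. good H n R" ..
  qed
  then obtain H where H: "\<And>n. good H n (H n)" by blast
  define y where "y n = \<sigma> (H n)" for n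
  \<comment> \<open>The recursion counts from 0 and the subsystem from 1, so \<open>H 0\<close> is
    left out.\<close>
  have "sum_subsystem y x"
    unfolding sum_subsystem_def
    by (rule exI[of _ H]) (use H in \<open>auto simp: good_def y_def \<sigma>_def\<close>)
  moreover have "(\<Sum>k\<in>F. y k) \<in> A \<and> (\<Prod>k\<in>F. y k) \<in> A" if "F \<in> \<P>\<^sub>f \<nat>\<^sub>+" for F
  proof -
    have fin: "finite F" "Max F \<in> F" using that by (auto simp: fin_nonempty_def)
    then have "F - {Max F} \<subseteq> {..<Max F}" by (auto simp: order_less_le)
    then have "(\<Sum>k\<in>F - {Max F}. y k) + y (Max F) \<in> B"
      "(\<Prod>k\<in>F - {Max F}. y k) * y (Max F) \<in> A"
      using H[of "Max F"] unfolding good_def y_def by blast+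
    then show ?thesis
      by (simp add: sum.remove[OF fin] prod.remove[OF fin] add.commute mult.commute B_def)
  qed
  ultimately show ?thesis
    by (intro exI[of _ y]) (auto simp: FS_def FP_def)
qed

end
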